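(* Let $p\ge 3$ be an integer and let $\alpha\ge 1$. The estimator $$\delta_\alpha(X)=\left(1-\frac{\phi_\alpha(\|X\|^2)}{\|X\|^2}\right)X,\qquad \phi_\alpha(w)=w\,\frac{\int_0^1\lambda^{\alpha(p/2-1)}\exp(-w\alpha\lambda/2)\,d\lambda}{\int_0^1\lambda^{\alpha(p/2-1)-1}\exp(-w\alpha\lambda/2)\,d\lambda},$$ of the mean vector $\theta$ based on $X\sim N_p(\theta,I_p)$ is quasi-admissible.
   Context: $\|\cdot\|$ is the Euclidean norm on $\mathbb{R}^p$ and $\nabla=(\partial/\partial x_1,\dots,\partial/\partial x_p)'$. For a positive differentiable function $m$ on $(0,\infty)$, let $\delta_m$ be the estimator $\delta_m(x)=x+\nabla\log m(\|x\|^2)=\{1+2m'(\|x\|^2)/m(\|x\|^2)\}x$ (for $x\neq 0$). Competitors of $\delta_m$ are the estimators $\delta_{m,k}(x)=\delta_m(x)+k(\|x\|^2)x$ with $k:(0,\infty)\to\mathbb{R}$ differentiable. The difference of the unbiased risk estimators (under loss $\|\delta-\theta\|^2$) of $\delta_{m,k}$ and $\delta_m$ is, with $w=\|x\|^2$, $$\Delta(m,mk)(w)=4w\frac{m'(w)}{m(w)}k(w)+2p\,k(w)+4w\,k'(w)+w\,k(w)^2 .$$ An estimator of the form $\delta_m$ is called quasi-admissible if there exists no differentiable $k$ such that $\Delta(m,mk)(w)\le 0$ for all $w>0$ with strict inequality for some $w$. (Since $\Delta$ depends on $m$ only through $m'/m$, which is determined by $\delta_m$, this is a property of the estimator.) 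*)

theory Defs
  imports "HOL-Analysis.Analysis"
begin

definition grad :: "(real ^ 'n \<Rightarrow> real) \<Rightarrow> real ^ 'n \<Rightarrow> real ^ 'n" where
  "grad f x = (\<chi> i. deriv (\<lambda>t. f (x + t *\<^sub>R axis i 1)) 0)"

definition pos_differentiable :: "(real \<Rightarrow> real) \<Rightarrow> bool" where
  "pos_differentiable m \<longleftrightarrow> (\<forall>w>0. m w > 0) \<and> m differentiable_on {0<..}"

text \<open>The value at \<open>x = 0\<close> is meaningless and never used.\<close>

definition delta_m :: "(real \<Rightarrow> real) \<Rightarrow> real ^ 'n \<Rightarrow> real ^ 'n" where
  "delta_m m x = x + grad (\<lambda>y. ln (m ((norm y)\<^sup>2))) x"

text \<open>For \<open>X \<sim> N\<^sub>p(\<theta>, I\<^sub>p)\<close> and squared error loss, \<open>risk_diff p m k (\<parallel>x\<parallel>\<^sup>2)\<close> is the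
  difference \<open>\<Delta>(m, mk)\<close> between the unbiased risk estimators (Stein) of
  \<open>x \<mapsto> delta_m m x + k (\<parallel>x\<parallel>\<^sup>2) x\<close> and of \<open>delta_m m\<close>.\<close>

definition risk_diff :: "nat \<Rightarrow> (real \<Rightarrow> real) \<Rightarrow> (real \<Rightarrow> real) \<Rightarrow> real \<Rightarrow> real" where
  "risk_diff p m k w =
     4 * w * (deriv m w / m w) * k w + 2 * real p * k w + 4 * w * deriv k w + w * (k w)\<^sup>2"

text \<open>An estimator of the form \<open>delta_m m\<close> determines \<open>m'/m\<close> on \<open>(0, \<infinity>)\<close>, and \<open>risk_diff\<close>
  depends on \<open>m\<close> only through \<open>m'/m\<close>; hence the choice of the representing \<open>m\<close> is immaterial.\<close>

definition quasi_admissible :: "(real ^ 'n \<Rightarrow> real ^ 'n) \<Rightarrow> bool" where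
  "quasi_admissible d \<longleftrightarrow>
     (\<exists>m. pos_differentiable m \<and> (\<forall>x. x \<noteq> 0 \<longrightarrow> d x = delta_m m x) \<and>
       \<not> (\<exists>k. k differentiable_on {0<..} \<and>
             (\<forall>w>0. risk_diff CARD('n) m k w \<le> 0) \<and>
             (\<exists>w>0. risk_diff CARD('n) m k w < 0)))"

definition phi_alpha :: "nat \<Rightarrow> real \<Rightarrow> real \<Rightarrow> real" where
  "phi_alpha p \<alpha> w = w *
     (integral {0..1} (\<lambda>t. t powr (\<alpha> * (real p / 2 - 1)) * exp (- (w * \<alpha> * t / 2))) /
      integral {0..1} (\<lambda>t. t powr (\<alpha> * (real p / 2 - 1) - 1) * exp (- (w * \<alpha> * t / 2))))"

definition delta_alpha :: "real \<Rightarrow> real ^ 'n \<Rightarrow> real ^ 'n" where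
  "delta_alpha \<alpha> x = (1 - phi_alpha CARD('n) \<alpha> ((norm x)\<^sup>2) / (norm x)\<^sup>2) *\<^sub>R x"

lemma delta_m_eq:
  fixes x :: "real ^ 'n"
  assumes m: "pos_differentiable m" and x: "x \<noteq> 0"
  shows "delta_m m x = (1 + 2 * deriv m ((norm x)\<^sup>2) / m ((norm x)\<^sup>2)) *\<^sub>R x"
proof -
  define w where "w = (norm x)\<^sup>2"
  have w: "w > 0" using x by (simp add: w_def)
  have mw: "m w > 0" using m w by (simp add: pos_differentiable_def)
  have "m differentiable (at w)"
    using m w by (auto simp: pos_differentiable_def differentiable_on_def at_within_open[of _ "{0<..}"])
  then have D: "(m has_real_derivative deriv m w) (at w)"
    by (simp add: DERIV_deriv_iff_real_differentiable)
  have "deriv (\<lambda>t. ln (m ((norm (x + t *\<^sub>R axis i 1))\<^sup>2))) 0 = 2 * deriv m w / m w * x $ i" for i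
  proof (rule DERIV_imp_deriv)
    have eq: "(norm (x + t *\<^sub>R axis i 1))\<^sup>2 = w + 2 * t * x $ i + t\<^sup>2" for t
      unfolding w_def power2_norm_eq_inner
      by (simp add: inner_add_left inner_add_right inner_axis inner_axis_axis
          inner_commute[of "axis i 1" x] power2_eq_square algebra_simps)
    have q: "((\<lambda>t. w + 2 * t * x $ i + t\<^sup>2) has_real_derivative 2 * x $ i) (at 0)"
      by (auto intro!: derivative_eq_intros)
    have "((\<lambda>t. m (w + 2 * t * x $ i + t\<^sup>2)) has_real_derivative deriv m w * (2 * x $ i)) (at 0)"
      by (rule DERIV_chain2[OF _ q]) (use D in simp)
    then have "((\<lambda>t. ln (m (w + 2 * t * x $ i + t\<^sup>2))) has_real_derivative
        1 / m w * (deriv m w * (2 * x $ i))) (at 0)"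
      by (intro DERIV_chain2[of ln]) (use mw in \<open>auto intro!: derivative_eq_intros\<close>)
    then show "((\<lambda>t. ln (m ((norm (x + t *\<^sub>R axis i 1))\<^sup>2))) has_field_derivative
        2 * deriv m w / m w * x $ i) (at 0)"
      by (simp add: eq algebra_simps)
  qed
  then show ?thesis
    by (simp add: delta_m_def grad_def vec_eq_iff w_def algebra_simps)
qed

end

theory Submission
  imports Defs
begin

text \<open>
  Writing \<open>g w = w powr (p / 2) * m w\<close> and \<open>h = g * k\<close>, one has
  \<open>\<Delta>(m, mk) = (4 * w / g) * (h' + h\<^sup>2 / (4 * g))\<close>, so \<open>\<Delta> \<le> 0\<close> is the Riccati inequality
  \<open>h' \<le> - h\<^sup>2 / (4 * g)\<close>, that is \<open>(1 / h)' \<ge> 1 / (4 * g)\<close> wherever \<open>h \<noteq> 0\<close>.  If \<open>1 / g\<close> is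
  integrable neither at \<open>0\<close> nor at \<open>\<infinity>\<close>, then \<open>1 / h\<close> would reach zero, to the right of a point
  where \<open>h < 0\<close> or to the left of a point where \<open>h > 0\<close>; hence \<open>h = 0\<close>.
  The estimator \<open>\<delta>\<^sub>\<alpha>\<close> is \<open>\<delta>\<^sub>m\<close> for \<open>m w = (\<integral>\<^sub>0\<^sup>1 t powr (a - 1) * exp (- \<alpha> w t / 2) dt) powr (1 / \<alpha>)\<close>
  with \<open>a = \<alpha> (p / 2 - 1)\<close>.  The integral is at most \<open>\<Gamma>(a) * (\<alpha> w / 2) powr - a\<close>, so
  \<open>g w \<le> C * w\<close>, which settles both ends at once.
\<close>

lemma riccati_inequality_imp_zero:
  fixes h h' :: "real \<Rightarrow> real"
  assumes D: "D > 0"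
    and deriv: "\<And>w. w > 0 \<Longrightarrow> (h has_real_derivative h' w) (at w)"
    and le: "\<And>w. w > 0 \<Longrightarrow> h' w \<le> - (h w)\<^sup>2 / (D * w)"
    and "x > 0"
  shows "h x = 0"
proof (rule ccontr)
  assume hx: "h x \<noteq> 0"
  have h'_le: "h' w \<le> 0" if "w > 0" for w
    by (rule order_trans[OF le[OF that]]) (use that D in simp)
  have anti: "h v \<le> h u" if "0 < u" "u \<le> v" for u v
    by (rule DERIV_nonpos_imp_nonincreasing[OF that(2)])
       (use that deriv h'_le in \<open>meson less_le_trans\<close>)
  \<comment> \<open>By the Riccati inequality its derivative
    \<open>- h' w / (h w)^2 - 1 / (D * w)\<close> is nonnegative wherever \<open>h\<close> has no
    zero.\<close>
  define \<psi> where "\<psi> w = 1 / h w - ln w / D" for w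
  have mono: "\<psi> u \<le> \<psi> v" if uv: "0 < u" "u \<le> v" and nz: "\<And>w. u \<le> w \<Longrightarrow> w \<le> v \<Longrightarrow> h w \<noteq> 0" for u v
  proof (rule DERIV_nonneg_imp_nondecreasing[OF uv(2)])
    fix w assume w: "u \<le> w" "w \<le> v"
    have w0: "w > 0" and hw: "h w \<noteq> 0" using uv w nz by auto
    have "(\<psi> has_real_derivative - (h' w / (h w)\<^sup>2) - 1 / (D * w)) (at w)"
      unfolding \<psi>_def using w0 hw D deriv[OF w0]
      by (auto intro!: derivative_eq_intros simp: field_simps power2_eq_square)
    moreover have "- (h' w / (h w)\<^sup>2) - 1 / (D * w) \<ge> 0"
      using le[OF w0] w0 hw D by (simp add: field_simps)
    ultimately show "\<exists>y. (\<psi> has_real_derivative y) (at w) \<and> 0 \<le> y" by blast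
  qed
  \<comment> \<open>Chosen so that \<open>ln y / D = ln x / D - 1 / h x\<close>, which makes the
    increment of \<open>\<psi>\<close> from \<open>x\<close> to \<open>y\<close> equal to
    \<open>1 / h y\<close>. As \<open>h\<close> is antitone, it keeps the sign of \<open>h x\<close>
    between \<open>x\<close> and \<open>y\<close>, while monotonicity of \<open>\<psi>\<close> gives
    \<open>1 / h y\<close> the opposite weak sign.\<close>
  define y where "y = x * exp (- D / h x)"
  have y: "y > 0" using \<open>x > 0\<close> by (simp add: y_def)
  have "ln y = ln x - D / h x"
    using \<open>x > 0\<close> by (simp add: y_def ln_mult)
  then have \<psi>_eq: "\<psi> y - \<psi> x = 1 / h y"
    using D by (simp add: \<psi>_def diff_divide_distrib)
  show False
  proof (cases "h x < 0")
    case True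
    then have "x \<le> y" using \<open>x > 0\<close> D by (simp add: y_def divide_nonneg_neg divide_le_0_iff)
    have neg: "h w < 0" if "x \<le> w" for w using anti[OF \<open>x > 0\<close> that] True by simp
    have "\<psi> x \<le> \<psi> y" by (rule mono[OF \<open>x > 0\<close> \<open>x \<le> y\<close>]) (use neg in force)
    moreover have "1 / h y < 0" using neg[OF \<open>x \<le> y\<close>] by simp
    ultimately show False using \<psi>_eq by simp
  next
    case False
    then have pos: "h x > 0" using hx by simp
    then have "y \<le> x" using \<open>x > 0\<close> D by (simp add: y_def mult_left_le)
    have pos: "h w > 0" if "0 < w" "w \<le> x" for w using anti[OF that] pos by simp
    have "\<psi> y \<le> \<psi> x" by (rule mono[OF y \<open>y \<le> x\<close>]) (use pos[OF less_le_trans[OF y]] in force)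
    moreover have "1 / h y > 0" using pos[OF y \<open>y \<le> x\<close>] by simp
    ultimately show False using \<psi>_eq by simp
  qed
qed

lemma risk_diff_nonpos_imp_zero:
  assumes m: "pos_differentiable m"
    and bound: "\<And>w. w > 0 \<Longrightarrow> w powr (real p / 2) * m w \<le> C * w"
    and k: "k differentiable_on {0<..}"
    and le: "\<And>w. w > 0 \<Longrightarrow> risk_diff p m k w \<le> 0"
    and x: "x > 0"
  shows "k x = 0"
proof -
  define g where "g w = w powr (real p / 2) * m w" for w
  have mpos: "m w > 0" if "w > 0" for w using m that by (simp add: pos_differentiable_def)
  have gpos: "g w > 0" if "w > 0" for w using mpos[OF that] that by (simp add: g_def)
  have C: "C > 0" using gpos[of 1] bound[of 1] by (simp add: g_def)
  have Dm: "(m has_real_derivative deriv m w) (at w)" and Dk: "(k has_real_derivative deriv k w) (at w)"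
    if "w > 0" for w
    using m k that
    by (auto simp: pos_differentiable_def differentiable_on_def at_within_open[of _ "{0<..}"]
        DERIV_deriv_iff_real_differentiable)
  define g' where "g' w = g w * (real p / (2 * w) + deriv m w / m w)" for w
  have Dg: "(g has_real_derivative g' w) (at w)" if w: "w > 0" for w
  proof -
    have "(g has_real_derivative
        real p / 2 * w powr (real p / 2 - 1) * m w + w powr (real p / 2) * deriv m w) (at w)"
      unfolding g_def using w Dm[OF w] by (auto intro!: derivative_eq_intros)
    moreover have "w powr (real p / 2 - 1) = w powr (real p / 2) / w"
      using w by (simp add: powr_diff)
    then have "real p / 2 * w powr (real p / 2 - 1) * m w + w powr (real p / 2) * deriv m w = g' w"
      using w mpos[OF w] by (simp add: g'_def g_def field_simps)
    ultimately show ?thesis by simp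
  qed
  \<comment> \<open>The constant \<open>4 * C\<close> comes from replacing \<open>g w\<close> by its
    upper bound \<open>C * w\<close> in
    \<open>(g w * k w)^2 / (4 * g w) = g w * (k w)^2 / 4\<close>.\<close>
  have "g x * k x = 0"
  proof (rule riccati_inequality_imp_zero[where D = "4 * C" and h = "\<lambda>w. g w * k w"
        and h' = "\<lambda>w. g' w * k w + g w * deriv k w"])
    fix w :: real assume w: "w > 0"
    show "((\<lambda>w. g w * k w) has_real_derivative g' w * k w + g w * deriv k w) (at w)"
      using Dg[OF w] Dk[OF w] by (auto intro!: derivative_eq_intros)
    have "risk_diff p m k w * g w = 4 * w * (g' w * k w + g w * deriv k w) + w * g w * (k w)\<^sup>2"
      using w mpos[OF w] by (simp add: risk_diff_def g'_def field_simps)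
    moreover have "risk_diff p m k w * g w \<le> 0"
      using le[OF w] gpos[OF w] by (simp add: mult_le_0_iff)
    ultimately have "w * (4 * (g' w * k w + g w * deriv k w) + g w * (k w)\<^sup>2) \<le> 0"
      by (simp add: algebra_simps)
    then have *: "g' w * k w + g w * deriv k w \<le> - (g w * (k w)\<^sup>2 / 4)"
      using w by (simp add: mult_le_0_iff)
    have "g w * (g w * (k w)\<^sup>2) \<le> C * w * (g w * (k w)\<^sup>2)"
      using bound[OF w] gpos[OF w] by (intro mult_right_mono) (auto simp: g_def)
    then have "(g w * k w)\<^sup>2 / (4 * C * w) \<le> g w * (k w)\<^sup>2 / 4"
      using C w by (simp add: power2_eq_square field_simps)
    with * show "g' w * k w + g w * deriv k w \<le> - (g w * k w)\<^sup>2 / (4 * C * w)" by simp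
  qed (use C x in auto)
  then show ?thesis using gpos[OF x] by simp
qed

lemma quasi_admissible_delta_m:
  assumes m: "pos_differentiable m"
    and bound: "\<And>w. w > 0 \<Longrightarrow> w powr (real CARD('n) / 2) * m w \<le> C * w"
    and d: "\<And>x. x \<noteq> 0 \<Longrightarrow> d x = delta_m m x"
  shows "quasi_admissible (d :: real ^ 'n \<Rightarrow> real ^ 'n)"
  unfolding quasi_admissible_def
proof (intro exI[of _ m] conjI allI impI notI)
  show "pos_differentiable m" by (fact m)
  show "d x = delta_m m x" if "x \<noteq> 0" for x using that by (rule d)
  assume "\<exists>k. k differentiable_on {0<..} \<and> (\<forall>w>0. risk_diff CARD('n) m k w \<le> 0) \<and>
    (\<exists>w>0. risk_diff CARD('n) m k w < 0)"
  then obtain k w where k: "k differentiable_on {0<..}" "\<And>w. w > 0 \<Longrightarrow> risk_diff CARD('n) m k w \<le> 0"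
    and w: "w > 0" "risk_diff CARD('n) m k w < 0" by blast
  have zero: "k x = 0" if "x > 0" for x
    by (rule risk_diff_nonpos_imp_zero[OF m bound k that])
  \<comment> \<open>\<open>k\<close> is arbitrary off the half-line, but it agrees with 0 on an open
    set around \<open>w\<close>; hence all terms of \<open>risk_diff\<close> vanish there, against
    strictness.\<close>
  have "(k has_real_derivative 0) (at w)"
    by (rule has_field_derivative_transform_within_open[of "\<lambda>_. 0" 0 w "{0<..}"])
       (use w zero in auto)
  then have "deriv k w = 0" by (rule DERIV_imp_deriv)
  with zero[OF w(1)] w(2) show False by (simp add: risk_diff_def)
qed

text \<open>For a, c > 0 this is \<open>c powr - a\<close> times the lower incomplete Gamma function
  at c. The two integrals in \<open>phi_alpha\<close> are its values at parameters
  \<open>a + 1\<close> and \<open>a\<close>.\<close>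

definition trunc_Gamma :: "real \<Rightarrow> real \<Rightarrow> real" where
  "trunc_Gamma a c = integral {0..1} (\<lambda>t. t powr (a - 1) * exp (- (c * t)))"

text \<open>Substitute \<open>s = c * t\<close> in the Gamma integral cut off at c. Integrability
  near 0, where the integrand is unbounded for a < 1, is inherited from the full Gamma
  integral.\<close>

lemma trunc_Gamma_scaling:
  fixes a c :: real
  assumes a: "a > 0" and c: "c > 0"
  shows "((\<lambda>t. t powr (a - 1) * exp (- (c * t))) has_integral
      integral {0..c} (\<lambda>t. t powr (a - 1) / exp t) / c powr a) {0..1}"
proof -
  define f where "f t = t powr (a - 1) / exp t" for t :: real
  have "f integrable_on {0..}"
    using Gamma_integral_real[OF a] by (auto simp: f_def[abs_def] integrable_on_def)
  then have "f integrable_on cbox 0 c" by (rule integrable_on_subcbox) auto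
  then have "(f has_integral integral {0..c} f) {0..c}" by auto
  from has_integral_stretch_real[OF this, of c]
  have "((\<lambda>t. f (c * t)) has_integral integral {0..c} f / c) {0..1}"
    using c by (simp add: image_divide_atLeastAtMost)
  from has_integral_mult_right[OF this, of "c powr (1 - a)"]
  have "((\<lambda>t. c powr (1 - a) * f (c * t)) has_integral integral {0..c} f / c powr a) {0..1}"
    using c by (simp add: powr_diff)
  then show ?thesis
    unfolding f_def[symmetric]
    by (rule has_integral_eq[rotated])
       (use c in \<open>simp add: f_def powr_mult powr_diff exp_minus field_simps\<close>)
qed

lemma trunc_Gamma_integrable:
  "a > 0 \<Longrightarrow> c > 0 \<Longrightarrow> (\<lambda>t. t powr (a - 1) * exp (- (c * t))) integrable_on {0..1::real}"
  using trunc_Gamma_scaling by blast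

lemma trunc_Gamma_le:
  assumes "a > 0" "c > 0"
  shows "trunc_Gamma a c \<le> Gamma a / c powr a"
proof -
  have f: "((\<lambda>t. t powr (a - 1) / exp t) has_integral Gamma a) {0..}"
    by (rule Gamma_integral_real) fact
  then have int: "(\<lambda>t. t powr (a - 1) / exp t) integrable_on {0..}" by blast
  have "integral {0..c} (\<lambda>t. t powr (a - 1) / exp t) \<le> integral {0..} (\<lambda>t. t powr (a - 1) / exp t)"
    by (rule integral_subset_le) (use int integrable_on_subcbox[OF int, of 0 c] in auto)
  also have "\<dots> = Gamma a" using f by (rule integral_unique)
  finally show ?thesis
    unfolding trunc_Gamma_def integral_unique[OF trunc_Gamma_scaling[OF assms]]
    by (rule divide_right_mono) simp
qed

lemma trunc_Gamma_pos:
  assumes "a > 0" "c > 0"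
  shows "trunc_Gamma a c > 0"
proof -
  \<comment> \<open>On the unit interval \<open>exp (- (c * t))\<close> is at least
    \<open>exp (- c)\<close>, which leaves an explicit power integral as a positive lower
    bound.\<close>
  have "((\<lambda>t. t powr (a - 1) * exp (- c)) has_integral (1 powr (a - 1 + 1) / (a - 1 + 1)) * exp (- c)) {0..1}"
    by (intro has_integral_mult_left has_integral_powr_from_0) (use assms in auto)
  then have "(1 powr (a - 1 + 1) / (a - 1 + 1)) * exp (- c) \<le> trunc_Gamma a c"
    unfolding trunc_Gamma_def
    by (rule has_integral_le[OF _ integrable_integral[OF trunc_Gamma_integrable[OF assms]]])
       (use assms in \<open>auto intro!: mult_left_mono simp: mult_left_le\<close>)
  moreover have "(1 powr (a - 1 + 1) / (a - 1 + 1)) * exp (- c) > 0" using assms by simp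
  ultimately show ?thesis by linarith
qed

text \<open>Differentiation under the integral sign: the factor t gained from the exponential makes
  the differentiated integrand continuous up to t = 0, even when the original one is singular
  there.\<close>

lemma DERIV_trunc_Gamma:
  assumes a: "a > 0" and c: "c > 0"
  shows "(trunc_Gamma a has_real_derivative - trunc_Gamma (a + 1) c) (at c)"
proof -
  have "((\<lambda>c. integral (cbox 0 1) (\<lambda>t. t powr (a - 1) * exp (- (c * t)))) has_real_derivative
      integral (cbox 0 1) (\<lambda>t. - (t powr a * exp (- (c * t))))) (at c within {0<..})"
  proof (rule leibniz_rule_field_derivative)
    fix c t :: real assume "c \<in> {0<..}" "t \<in> cbox 0 1"
    then show "((\<lambda>c. t powr (a - 1) * exp (- (c * t))) has_real_derivative
        - (t powr a * exp (- (c * t)))) (at c within {0<..})"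
      \<comment> \<open>At t = 0 both sides vanish, since \<open>0 powr x = 0\<close> for every
        x.\<close>
      using a by (cases "t = 0") (auto intro!: derivative_eq_intros simp: powr_diff)
  next
    fix c :: real assume "c \<in> {0<..}"
    then show "(\<lambda>t. t powr (a - 1) * exp (- (c * t))) integrable_on cbox 0 1"
      using trunc_Gamma_integrable[OF a] by auto
  next
    show "continuous_on ({0<..} \<times> cbox 0 1) (\<lambda>(c, t). - (t powr a * exp (- (c * t))))"
      unfolding case_prod_unfold
      by (intro continuous_intros continuous_on_powr') (use a in auto)
  qed (use c in auto)
  then show ?thesis
    using c by (simp add: trunc_Gamma_def[abs_def] at_within_open[of _ "{0<..}"])
qed

theorem corollary3p1:
  fixes \<alpha> :: real
  assumes "CARD('n::finite) \<ge> 3" and "\<alpha> \<ge> 1"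
  shows "quasi_admissible (delta_alpha \<alpha> :: real ^ 'n \<Rightarrow> real ^ 'n)"
proof -
  define p where "p = CARD('n)"
  define a where "a = \<alpha> * (real p / 2 - 1)"
  define G where "G w = trunc_Gamma a (\<alpha> / 2 * w)" for w
  \<comment> \<open>The root cancels the factor \<alpha> that the chain rule produces in
    \<open>G'\<close>: \<open>2 * m' / m = (2 / \<alpha>) * G' / G\<close>, which is minus the
    quotient of the two integrals in \<open>phi_alpha\<close>.\<close>
  define m where "m w = G w powr (1 / \<alpha>)" for w
  have \<alpha>: "\<alpha> > 0" and a: "a > 0" using assms by (auto simp: a_def p_def)
  have Gpos: "G w > 0" if "w > 0" for w using that \<alpha> a by (simp add: G_def trunc_Gamma_pos)
  have DG: "(G has_real_derivative - trunc_Gamma (a + 1) (\<alpha> / 2 * w) * (\<alpha> / 2)) (at w)" if "w > 0" for w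
    unfolding G_def by (rule DERIV_chain2[OF DERIV_trunc_Gamma])
      (use that a \<alpha> in \<open>auto intro!: derivative_eq_intros\<close>)
  have Dm: "(m has_real_derivative - m w * trunc_Gamma (a + 1) (\<alpha> / 2 * w) / (2 * G w)) (at w)"
    if "w > 0" for w
  proof -
    have "G w powr (1 / \<alpha> - 1) = m w / G w"
      using Gpos[OF that] by (simp add: m_def powr_diff)
    with DERIV_fun_powr[OF DG[OF that] Gpos[OF that], of "1 / \<alpha>"] \<alpha> show ?thesis
      by (simp add: m_def[abs_def] mult.commute[of 2 "G w"])
  qed
  have m: "pos_differentiable m"
    unfolding pos_differentiable_def differentiable_on_def
  proof (intro conjI ballI allI impI)
    show "m w > 0" if "w > 0" for w using Gpos[OF that] by (simp add: m_def)
    show "m differentiable (at w within {0<..})" if "w \<in> {0<..}" for w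
      using Dm[of w] that by (meson differentiable_at_withinI greaterThan_iff real_differentiable_def)
  qed
  show ?thesis
  proof (rule quasi_admissible_delta_m[OF m])
    fix w :: real assume w: "w > 0"
    have "m w \<le> (Gamma a / (\<alpha> / 2 * w) powr a) powr (1 / \<alpha>)"
      unfolding m_def
      by (rule powr_mono2) (use Gpos[OF w] trunc_Gamma_le[OF a, of "\<alpha> / 2 * w"] \<alpha> w in \<open>auto simp: G_def\<close>)
    \<comment> \<open>The root turns the exponent \<open>a\<close> into \<open>p / 2 - 1\<close>, so
      multiplying by \<open>w powr (p / 2)\<close> leaves exactly one factor
      \<open>w\<close>.\<close>
    also have "\<dots> = (Gamma a / (\<alpha> / 2) powr a) powr (1 / \<alpha>) / w powr (real p / 2 - 1)"
    proof -
      have "a * (1 / \<alpha>) = real p / 2 - 1" using \<alpha> by (simp add: a_def)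
      then have "(w powr a) powr (1 / \<alpha>) = w powr (real p / 2 - 1)" by (simp only: powr_powr)
      moreover have "Gamma a / (\<alpha> / 2 * w) powr a = Gamma a / (\<alpha> / 2) powr a / w powr a"
        by (simp only: powr_mult divide_divide_eq_left)
      ultimately show ?thesis by (simp only: powr_divide)
    qed
    finally have "w powr (real p / 2) * m w \<le>
        w powr (real p / 2) * ((Gamma a / (\<alpha> / 2) powr a) powr (1 / \<alpha>) / w powr (real p / 2 - 1))"
      by (intro mult_left_mono) auto
    also have "\<dots> = (Gamma a / (\<alpha> / 2) powr a) powr (1 / \<alpha>) * w"
      using w by (simp add: powr_diff)
    finally show "w powr (real CARD('n) / 2) * m w \<le> (Gamma a / (\<alpha> / 2) powr a) powr (1 / \<alpha>) * w"
      by (simp add: p_def)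
  next
    fix x :: "real ^ 'n" assume x: "x \<noteq> 0"
    define w where "w = (norm x)\<^sup>2"
    have w: "w > 0" using x by (simp add: w_def)
    have phi: "phi_alpha p \<alpha> w = w * (trunc_Gamma (a + 1) (\<alpha> / 2 * w) / G w)"
      by (simp add: phi_alpha_def trunc_Gamma_def G_def a_def mult.commute mult.left_commute)
    have "m w > 0" using Gpos[OF w] by (simp add: m_def)
    then have "1 - phi_alpha p \<alpha> w / w = 1 + 2 * deriv m w / m w"
      using w Gpos[OF w] unfolding phi DERIV_imp_deriv[OF Dm[OF w]] by (simp add: field_simps)
    then show "delta_alpha \<alpha> x = delta_m m x"
      by (simp add: delta_m_eq[OF m x] delta_alpha_def w_def p_def)
  qed
qed

end
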